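(* A dagger kernel category is Boolean if and only if, for each object $X$, the orthomodular lattice $\mathrm{KSub}(X)$ is a Boolean algebra.
   Context: A dagger category is a category with a contravariant functor $\dagger$ that is the identity on objects with $f^{\dagger\dagger}=f$; $f$ is a dagger mono if $f^\dagger\circ f=\mathrm{id}$. A dagger kernel category is a dagger category with a zero object $0$ in which every morphism $f$ has a kernel (universal $k$ with $f\circ k=0$) that can be chosen to be a dagger mono, denoted $\ker(f)$. $m^\perp=\ker(m^\dagger)$. $\mathrm{KSub}(X)$ is the poset of kernels with codomain $X$ modulo isomorphism of domains, with $m\le n$ iff $m=n\circ\varphi$ for some $\varphi$; it is an orthomodular lattice with meets given by pullback, joins $m\vee n=(m^\perp\wedge n^\perp)^\perp$, bottom $0$, top $1=\mathrm{id}_X$, and orthocomplement $(-)^\perp$. The dagger kernel category is Boolean if for all kernels $m,n$ with common codomain, $m\wedge n=0$ implies $m^\dagger\circ n=0$. *)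

theory Defs
  imports "HOL-Algebra.Lattice"
begin

section \<open>Dagger categories\<close>

text \<open>\<open>g \<cdot> f\<close> is \<open>g\<close> after \<open>f\<close>, meaningful when \<open>Dom g = Cod f\<close>.\<close>

record ('o, 'm) dagger_cat =
  Obj :: "'o set"
  Arr :: "'m set"
  Dom :: "'m \<Rightarrow> 'o"
  Cod :: "'m \<Rightarrow> 'o"
  Id :: "'o \<Rightarrow> 'm"
  Comp :: "'m \<Rightarrow> 'm \<Rightarrow> 'm"  (infixr \<open>\<cdot>\<index>\<close> 70)
  Dag :: "'m \<Rightarrow> 'm"

definition Hom :: "('o, 'm, 'z) dagger_cat_scheme \<Rightarrow> 'o \<Rightarrow> 'o \<Rightarrow> 'm set" where
  "Hom C X Y = {f \<in> Arr C. Dom C f = X \<and> Cod C f = Y}"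

locale dagger_category =
  fixes C :: "('o, 'm, 'z) dagger_cat_scheme" (structure)
  assumes Dom_Obj: "f \<in> Arr C \<Longrightarrow> Dom C f \<in> Obj C"
    and Cod_Obj: "f \<in> Arr C \<Longrightarrow> Cod C f \<in> Obj C"
    and Id_Hom: "X \<in> Obj C \<Longrightarrow> Id C X \<in> Hom C X X"
    and Comp_Hom: "\<lbrakk>f \<in> Hom C X Y; g \<in> Hom C Y Z\<rbrakk> \<Longrightarrow> g \<cdot> f \<in> Hom C X Z"
    and Comp_Id: "f \<in> Hom C X Y \<Longrightarrow> f \<cdot> Id C X = f"
    and Id_Comp: "f \<in> Hom C X Y \<Longrightarrow> Id C Y \<cdot> f = f"
    and Comp_assoc:
      "\<lbrakk>f \<in> Hom C W X; g \<in> Hom C X Y; h \<in> Hom C Y Z\<rbrakk> \<Longrightarrow> (h \<cdot> g) \<cdot> f = h \<cdot> (g \<cdot> f)"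
    and Dag_Hom: "f \<in> Hom C X Y \<Longrightarrow> Dag C f \<in> Hom C Y X"
    and Dag_Id: "X \<in> Obj C \<Longrightarrow> Dag C (Id C X) = Id C X"
    and Dag_Comp: "\<lbrakk>f \<in> Hom C X Y; g \<in> Hom C Y Z\<rbrakk> \<Longrightarrow> Dag C (g \<cdot> f) = Dag C f \<cdot> Dag C g"
    and Dag_Dag: "f \<in> Arr C \<Longrightarrow> Dag C (Dag C f) = f"

definition dagger_mono :: "('o, 'm, 'z) dagger_cat_scheme \<Rightarrow> 'm \<Rightarrow> bool" where
  "dagger_mono C f \<longleftrightarrow> f \<in> Arr C \<and> Dag C f \<cdot>\<^bsub>C\<^esub> f = Id C (Dom C f)"

definition iso_arr :: "('o, 'm, 'z) dagger_cat_scheme \<Rightarrow> 'm \<Rightarrow> bool" where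
  "iso_arr C f \<longleftrightarrow> f \<in> Arr C \<and>
     (\<exists>g \<in> Hom C (Cod C f) (Dom C f).
        g \<cdot>\<^bsub>C\<^esub> f = Id C (Dom C f) \<and> f \<cdot>\<^bsub>C\<^esub> g = Id C (Cod C f))"

section \<open>Zero objects, kernels and pullbacks\<close>

definition zero_object :: "('o, 'm, 'z) dagger_cat_scheme \<Rightarrow> 'o \<Rightarrow> bool" where
  "zero_object C Z \<longleftrightarrow> Z \<in> Obj C \<and>
     (\<forall>X \<in> Obj C. (\<exists>!f. f \<in> Hom C X Z) \<and> (\<exists>!f. f \<in> Hom C Z X))"

definition zero_obj :: "('o, 'm, 'z) dagger_cat_scheme \<Rightarrow> 'o" where
  "zero_obj C = (SOME Z. zero_object C Z)"

definition zero_arr :: "('o, 'm, 'z) dagger_cat_scheme \<Rightarrow> 'o \<Rightarrow> 'o \<Rightarrow> 'm" where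
  "zero_arr C X Y =
     (THE f. \<exists>g \<in> Hom C X (zero_obj C). \<exists>h \<in> Hom C (zero_obj C) Y. f = h \<cdot>\<^bsub>C\<^esub> g)"

text \<open>\<open>kernel_of C f k\<close>: \<open>k\<close> has the universal property of a kernel of \<open>f\<close>.
  It is not required to be a dagger mono.\<close>

definition kernel_of :: "('o, 'm, 'z) dagger_cat_scheme \<Rightarrow> 'm \<Rightarrow> 'm \<Rightarrow> bool" where
  "kernel_of C f k \<longleftrightarrow> f \<in> Arr C \<and> k \<in> Arr C \<and> Cod C k = Dom C f \<and>
     f \<cdot>\<^bsub>C\<^esub> k = zero_arr C (Dom C k) (Cod C f) \<and>
     (\<forall>Z \<in> Obj C. \<forall>g \<in> Hom C Z (Dom C f). f \<cdot>\<^bsub>C\<^esub> g = zero_arr C Z (Cod C f) \<longrightarrow>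
        (\<exists>!h. h \<in> Hom C Z (Dom C k) \<and> k \<cdot>\<^bsub>C\<^esub> h = g))"

definition is_kernel :: "('o, 'm, 'z) dagger_cat_scheme \<Rightarrow> 'm \<Rightarrow> bool" where
  "is_kernel C k \<longleftrightarrow> (\<exists>f. kernel_of C f k)"

definition pullback :: "('o, 'm, 'z) dagger_cat_scheme \<Rightarrow> 'm \<Rightarrow> 'm \<Rightarrow> 'm \<Rightarrow> 'm \<Rightarrow> bool" where
  "pullback C m n p q \<longleftrightarrow> m \<in> Arr C \<and> n \<in> Arr C \<and> Cod C m = Cod C n \<and>
     p \<in> Hom C (Dom C p) (Dom C m) \<and> q \<in> Hom C (Dom C p) (Dom C n) \<and> m \<cdot>\<^bsub>C\<^esub> p = n \<cdot>\<^bsub>C\<^esub> q \<and>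
     (\<forall>Z \<in> Obj C. \<forall>f \<in> Hom C Z (Dom C m). \<forall>g \<in> Hom C Z (Dom C n). m \<cdot>\<^bsub>C\<^esub> f = n \<cdot>\<^bsub>C\<^esub> g \<longrightarrow>
        (\<exists>!h. h \<in> Hom C Z (Dom C p) \<and> p \<cdot>\<^bsub>C\<^esub> h = f \<and> q \<cdot>\<^bsub>C\<^esub> h = g))"

locale dagger_kernel_category = dagger_category +
  assumes zero_object_exists: "\<exists>Z. zero_object C Z"
    and dagger_kernel_exists: "f \<in> Arr C \<Longrightarrow> \<exists>k. kernel_of C f k \<and> dagger_mono C k"

definition ker :: "('o, 'm, 'z) dagger_cat_scheme \<Rightarrow> 'm \<Rightarrow> 'm" where
  "ker C f = (SOME k. kernel_of C f k \<and> dagger_mono C k)"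

definition perp :: "('o, 'm, 'z) dagger_cat_scheme \<Rightarrow> 'm \<Rightarrow> 'm" where
  "perp C m = ker C (Dag C m)"

section \<open>Boolean algebras as structures with a carrier\<close>

record 'a bounded_ortholattice = "'a gorder" +
  olmeet :: "'a \<Rightarrow> 'a \<Rightarrow> 'a"
  oljoin :: "'a \<Rightarrow> 'a \<Rightarrow> 'a"
  olcompl :: "'a \<Rightarrow> 'a"
  olbot :: 'a
  oltop :: 'a

text \<open>The operations of the structure must be those determined by its order;
  \<open>\<sqinter>\<close>, \<open>\<squnion>\<close>, \<open>\<bottom>\<close>, \<open>\<top>\<close> are the order-theoretic ones.\<close>

locale boolean_ortholattice = bounded_lattice L
  for L :: "('a, 'z) bounded_ortholattice_scheme" (structure) +
  assumes olmeet_eq: "\<lbrakk>x \<in> carrier L; y \<in> carrier L\<rbrakk> \<Longrightarrow> olmeet L x y = x \<sqinter> y"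
    and oljoin_eq: "\<lbrakk>x \<in> carrier L; y \<in> carrier L\<rbrakk> \<Longrightarrow> oljoin L x y = x \<squnion> y"
    and olbot_eq: "olbot L = \<bottom>"
    and oltop_eq: "oltop L = \<top>"
    and distrib: "\<lbrakk>x \<in> carrier L; y \<in> carrier L; z \<in> carrier L\<rbrakk>
      \<Longrightarrow> x \<sqinter> (y \<squnion> z) = (x \<sqinter> y) \<squnion> (x \<sqinter> z)"
    and olcompl_closed: "x \<in> carrier L \<Longrightarrow> olcompl L x \<in> carrier L"
    and meet_olcompl: "x \<in> carrier L \<Longrightarrow> x \<sqinter> olcompl L x = \<bottom>"
    and join_olcompl: "x \<in> carrier L \<Longrightarrow> x \<squnion> olcompl L x = \<top>"

section \<open>Kernel subobjects\<close>

definition kernels_into :: "('o, 'm, 'z) dagger_cat_scheme \<Rightarrow> 'o \<Rightarrow> 'm set" where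
  "kernels_into C X = {k. is_kernel C k \<and> Cod C k = X}"

definition ksub_rel :: "('o, 'm, 'z) dagger_cat_scheme \<Rightarrow> 'o \<Rightarrow> ('m \<times> 'm) set" where
  "ksub_rel C X = {(m, n). m \<in> kernels_into C X \<and> n \<in> kernels_into C X \<and>
     (\<exists>\<phi> \<in> Hom C (Dom C m) (Dom C n). iso_arr C \<phi> \<and> m = n \<cdot>\<^bsub>C\<^esub> \<phi>)}"

definition ksub_class :: "('o, 'm, 'z) dagger_cat_scheme \<Rightarrow> 'm \<Rightarrow> 'm set" where
  "ksub_class C m = ksub_rel C (Cod C m) `` {m}"

definition ksub_le :: "('o, 'm, 'z) dagger_cat_scheme \<Rightarrow> 'm set \<Rightarrow> 'm set \<Rightarrow> bool" where
  "ksub_le C A B \<longleftrightarrow>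
     (\<exists>m \<in> A. \<exists>n \<in> B. \<exists>\<phi> \<in> Hom C (Dom C m) (Dom C n). m = n \<cdot>\<^bsub>C\<^esub> \<phi>)"

text \<open>The operations are lifted to classes by taking the union, over all representatives,
  of the classes of the results.\<close>

definition ksub_meet :: "('o, 'm, 'z) dagger_cat_scheme \<Rightarrow> 'm set \<Rightarrow> 'm set \<Rightarrow> 'm set" where
  "ksub_meet C A B =
     \<Union> {ksub_class C (m \<cdot>\<^bsub>C\<^esub> p) | m n p q. m \<in> A \<and> n \<in> B \<and> pullback C m n p q}"

definition ksub_perp :: "('o, 'm, 'z) dagger_cat_scheme \<Rightarrow> 'm set \<Rightarrow> 'm set" where
  "ksub_perp C A = (\<Union>m \<in> A. ksub_class C (perp C m))"

definition ksub_join :: "('o, 'm, 'z) dagger_cat_scheme \<Rightarrow> 'm set \<Rightarrow> 'm set \<Rightarrow> 'm set" where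
  "ksub_join C A B = ksub_perp C (ksub_meet C (ksub_perp C A) (ksub_perp C B))"

definition ksub_bot :: "('o, 'm, 'z) dagger_cat_scheme \<Rightarrow> 'o \<Rightarrow> 'm set" where
  "ksub_bot C X = ksub_class C (zero_arr C (zero_obj C) X)"

definition ksub_top :: "('o, 'm, 'z) dagger_cat_scheme \<Rightarrow> 'o \<Rightarrow> 'm set" where
  "ksub_top C X = ksub_class C (Id C X)"

definition KSub ::
  "('o, 'm, 'z) dagger_cat_scheme \<Rightarrow> 'o \<Rightarrow> 'm set bounded_ortholattice" where
  "KSub C X =
     \<lparr> carrier = kernels_into C X // ksub_rel C X,
       eq = (=),
       le = ksub_le C,
       olmeet = ksub_meet C,
       oljoin = ksub_join C,
       olcompl = ksub_perp C,
       olbot = ksub_bot C X,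
       oltop = ksub_top C X \<rparr>"

definition boolean_category :: "('o, 'm, 'z) dagger_cat_scheme \<Rightarrow> bool" where
  "boolean_category C \<longleftrightarrow>
     (\<forall>m n. is_kernel C m \<longrightarrow> is_kernel C n \<longrightarrow> Cod C m = Cod C n \<longrightarrow>
        ksub_meet C (ksub_class C m) (ksub_class C n) = ksub_bot C (Cod C m) \<longrightarrow>
        Dag C m \<cdot>\<^bsub>C\<^esub> n = zero_arr C (Dom C n) (Dom C m))"

end

theory Submission
  imports Defs
begin

text \<open>
  Send a kernel \<open>m\<close> into \<open>X\<close> to the set of all arrows into \<open>X\<close> that factor through \<open>m\<close>.
  This embeds \<open>KSub X\<close> into the sets of arrows into \<open>X\<close>: meets become intersections and the
  orthocomplement becomes the polar for the relation \<open>f\<^sup>\<dagger> \<circ> g = 0\<close>. The image consists of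
  sets equal to their double polar, and no nonzero arrow is orthogonal to itself, so \<open>KSub X\<close> is an
  ortholattice. The Boolean condition says that disjoint elements of \<open>KSub X\<close> are orthogonal, and an
  ortholattice has this property if and only if it is a Boolean algebra.
\<close>

section \<open>Ortholattices\<close>

text \<open>These are the laws that can be read off sieves of arrows directly. Joins enter only
  through De Morgan; their universal property and the law for
  \<open>x \<squnion> olcompl L x\<close> then follow by duality.\<close>

locale ortholattice = partial_order L
  for L :: "('a, 'z) bounded_ortholattice_scheme" (structure) +
  assumes olcompl_closed [simp]: "x \<in> carrier L \<Longrightarrow> olcompl L x \<in> carrier L"
    and olcompl_antitone: "\<lbrakk>x \<sqsubseteq> y; x \<in> carrier L; y \<in> carrier L\<rbrakk> \<Longrightarrow> olcompl L y \<sqsubseteq> olcompl L x"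
    and olcompl_olcompl [simp]: "x \<in> carrier L \<Longrightarrow> olcompl L (olcompl L x) = x"
    and olmeet_closed [simp]: "\<lbrakk>x \<in> carrier L; y \<in> carrier L\<rbrakk> \<Longrightarrow> olmeet L x y \<in> carrier L"
    and le_olmeet_iff: "\<lbrakk>x \<in> carrier L; y \<in> carrier L; z \<in> carrier L\<rbrakk>
      \<Longrightarrow> z \<sqsubseteq> olmeet L x y \<longleftrightarrow> z \<sqsubseteq> x \<and> z \<sqsubseteq> y"
    and oljoin_de_Morgan: "\<lbrakk>x \<in> carrier L; y \<in> carrier L\<rbrakk>
      \<Longrightarrow> oljoin L x y = olcompl L (olmeet L (olcompl L x) (olcompl L y))"
    and olbot_closed [simp]: "olbot L \<in> carrier L"
    and olbot_le: "x \<in> carrier L \<Longrightarrow> olbot L \<sqsubseteq> x"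
    and oltop_closed [simp]: "oltop L \<in> carrier L"
    and le_oltop: "x \<in> carrier L \<Longrightarrow> x \<sqsubseteq> oltop L"
    and olmeet_olcompl: "x \<in> carrier L \<Longrightarrow> olmeet L x (olcompl L x) = olbot L"
begin

section \<open>Lattice structure obtained by duality\<close>

lemma le_olcompl_iff:
  assumes "x \<in> carrier L" "y \<in> carrier L"
  shows "x \<sqsubseteq> olcompl L y \<longleftrightarrow> y \<sqsubseteq> olcompl L x"
  using olcompl_antitone[of x "olcompl L y"] olcompl_antitone[of y "olcompl L x"] assms by auto

lemma oljoin_closed [simp]: "\<lbrakk>x \<in> carrier L; y \<in> carrier L\<rbrakk> \<Longrightarrow> oljoin L x y \<in> carrier L"
  by (simp add: oljoin_de_Morgan)

text \<open>The complement is an antitone involution, so it carries the universal property of meets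
  to that of their De Morgan duals.\<close>

lemma oljoin_le_iff:
  assumes "x \<in> carrier L" "y \<in> carrier L" "z \<in> carrier L"
  shows "oljoin L x y \<sqsubseteq> z \<longleftrightarrow> x \<sqsubseteq> z \<and> y \<sqsubseteq> z"
proof -
  have compl_le: "olcompl L u \<sqsubseteq> v \<longleftrightarrow> olcompl L v \<sqsubseteq> u" if "u \<in> carrier L" "v \<in> carrier L" for u v
    using le_olcompl_iff[of "olcompl L u" "olcompl L v"] that by simp
  have "oljoin L x y \<sqsubseteq> z \<longleftrightarrow> olcompl L z \<sqsubseteq> olmeet L (olcompl L x) (olcompl L y)"
    using assms by (simp add: oljoin_de_Morgan compl_le)
  also have "\<dots> \<longleftrightarrow> olcompl L z \<sqsubseteq> olcompl L x \<and> olcompl L z \<sqsubseteq> olcompl L y"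
    using assms by (simp add: le_olmeet_iff)
  also have "\<dots> \<longleftrightarrow> x \<sqsubseteq> z \<and> y \<sqsubseteq> z"
    using assms le_olcompl_iff[of "olcompl L z"] by simp
  finally show ?thesis .
qed

lemma greatest_olmeet:
  assumes "x \<in> carrier L" "y \<in> carrier L"
  shows "greatest L (olmeet L x y) (Lower L {x, y})"
proof -
  have "olmeet L x y \<sqsubseteq> x \<and> olmeet L x y \<sqsubseteq> y"
    using le_olmeet_iff[of x y "olmeet L x y"] assms by simp
  then show ?thesis
    using assms by (auto simp: greatest_def Lower_def le_olmeet_iff)
qed

lemma least_oljoin:
  assumes "x \<in> carrier L" "y \<in> carrier L"
  shows "least L (oljoin L x y) (Upper L {x, y})"
proof -
  have "x \<sqsubseteq> oljoin L x y \<and> y \<sqsubseteq> oljoin L x y"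
    using oljoin_le_iff[of x y "oljoin L x y"] assms by simp
  then show ?thesis
    using assms by (auto simp: least_def Upper_def oljoin_le_iff)
qed

text \<open>The order-theoretic operations \<sqinter>, \<squnion>, \<bottom>, \<top> become
  available here. The lemmas that follow identify them with the fields of the record, as
  \<open>boolean_ortholattice\<close> demands.\<close>

sublocale bounded_lattice L
proof
  show "\<exists>x. least L x (carrier L)"
    by (rule exI[of _ "olbot L"]) (simp add: least_def olbot_le)
  show "\<exists>x. greatest L x (carrier L)"
    by (rule exI[of _ "oltop L"]) (simp add: greatest_def le_oltop)
qed (use greatest_olmeet least_oljoin in blast)+

lemma olmeet_eq_meet: "\<lbrakk>x \<in> carrier L; y \<in> carrier L\<rbrakk> \<Longrightarrow> olmeet L x y = x \<sqinter> y"
  using greatest_unique[OF greatest_olmeet inf_of_two_greatest] by (simp add: meet_def)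

lemma oljoin_eq_join: "\<lbrakk>x \<in> carrier L; y \<in> carrier L\<rbrakk> \<Longrightarrow> oljoin L x y = x \<squnion> y"
  using least_unique[OF least_oljoin sup_of_two_least] by (simp add: join_def)

lemma olbot_eq_bottom: "olbot L = \<bottom>"
  by (rule bottom_eq) (simp_all add: olbot_le)

lemma oltop_eq_top: "oltop L = \<top>"
  by (rule top_eq) (simp_all add: le_oltop)

lemma meet_olcompl_eq_bottom: "x \<in> carrier L \<Longrightarrow> x \<sqinter> olcompl L x = \<bottom>"
  using olmeet_olcompl olmeet_eq_meet olbot_eq_bottom by simp

text \<open>De Morgan turns the join into the complement of \<open>olmeet L (olcompl L x) x\<close>,
  that is of the bottom. That complement is the top because everything is orthogonal to the
  bottom.\<close>

lemma join_olcompl_eq_top: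
  assumes "x \<in> carrier L"
  shows "x \<squnion> olcompl L x = \<top>"
proof -
  have "olmeet L (olcompl L x) x = olbot L"
    using olmeet_olcompl[of "olcompl L x"] assms by simp
  then have "x \<squnion> olcompl L x = olcompl L (olbot L)"
    using assms oljoin_de_Morgan[of x "olcompl L x"] oljoin_eq_join[of x "olcompl L x"] by simp
  moreover have "olcompl L (olbot L) = \<top>"
    by (rule top_eq) (use le_olcompl_iff[of _ "olbot L"] olbot_le in auto)
  ultimately show ?thesis by simp
qed

section \<open>Boolean algebras as ortholattices whose disjoint elements are orthogonal\<close>

text \<open>Split \<open>y\<close> along \<open>x\<close> and \<open>olcompl L x\<close> by
  distributivity: the part in \<open>x\<close> vanishes, so \<open>y\<close> is its part in
  \<open>olcompl L x\<close>.\<close>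

lemma boolean_imp_disjoint_orthogonal:
  assumes "boolean_ortholattice L"
    and x: "x \<in> carrier L" and y: "y \<in> carrier L" and disj: "olmeet L x y = olbot L"
  shows "y \<sqsubseteq> olcompl L x"
proof -
  interpret B: boolean_ortholattice L by fact
  have "y = y \<sqinter> \<top>"
    using le_iff_join[of y \<top>] y top_higher by simp
  also have "\<dots> = y \<sqinter> (x \<squnion> olcompl L x)"
    using x by (simp add: join_olcompl_eq_top)
  also have "\<dots> = (y \<sqinter> x) \<squnion> (y \<sqinter> olcompl L x)"
    using x y by (simp add: B.distrib)
  also have "y \<sqinter> x = \<bottom>"
    using disj x y by (simp add: olmeet_eq_meet olbot_eq_bottom meet_comm)
  also have "\<bottom> \<squnion> (y \<sqinter> olcompl L x) = y \<sqinter> olcompl L x"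
    using le_iff_meet[of \<bottom> "y \<sqinter> olcompl L x"] x y bottom_lower by simp
  finally have "y = y \<sqinter> olcompl L x" .
  with le_iff_join[OF y olcompl_closed[OF x]] show ?thesis ..
qed

lemma disjoint_orthogonal_imp_boolean:
  assumes orth: "\<And>x y. \<lbrakk>x \<in> carrier L; y \<in> carrier L; x \<sqinter> y = \<bottom>\<rbrakk> \<Longrightarrow> y \<sqsubseteq> olcompl L x"
  shows "boolean_ortholattice L"
proof
  fix x y z
  assume [simp]: "x \<in> carrier L" "y \<in> carrier L" "z \<in> carrier L"
  \<comment> \<open>\<open>t\<close> is the part of \<open>x \<sqinter> (y \<squnion> z)\<close> orthogonal to \<open>w\<close>; it is disjoint from, hence
    orthogonal to, both \<open>y\<close> and \<open>z\<close>, yet it lies below \<open>y \<squnion> z\<close>, so it vanishes.\<close>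
  define w where "w = (x \<sqinter> y) \<squnion> (x \<sqinter> z)"
  define t where "t = olcompl L w \<sqinter> (x \<sqinter> (y \<squnion> z))"
  have [simp]: "w \<in> carrier L" "t \<in> carrier L"
    by (simp_all add: w_def t_def)
  have t_le: "t \<sqsubseteq> olcompl L w" "t \<sqsubseteq> x" "t \<sqsubseteq> y \<squnion> z"
    using meet_left[of "olcompl L w" "x \<sqinter> (y \<squnion> z)"] meet_right[of "olcompl L w" "x \<sqinter> (y \<squnion> z)"]
      meet_left[of x "y \<squnion> z"] meet_right[of x "y \<squnion> z"]
    by (auto simp: t_def intro: le_trans)
  \<comment> \<open>Such a \<open>u\<close> lies below the meet of \<open>v\<close> with its
    complement, which is the bottom.\<close>
  have bot: "u = \<bottom>" if "u \<in> carrier L" "v \<in> carrier L" "u \<sqsubseteq> v" "u \<sqsubseteq> olcompl L v" for u v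
  proof (rule bottom_eq)
    show "u \<sqsubseteq> a" if "a \<in> carrier L" for a
      using that \<open>u \<in> carrier L\<close> \<open>v \<in> carrier L\<close> \<open>u \<sqsubseteq> v\<close> \<open>u \<sqsubseteq> olcompl L v\<close>
        le_olmeet_iff[of v "olcompl L v" u] olbot_le[of a] olmeet_olcompl[of v]
        le_trans[of u "olbot L" a] by simp
  qed fact
  \<comment> \<open>Since \<open>t\<close> is below \<open>x\<close>, the element
    \<open>v \<sqinter> t\<close> is below \<open>x \<sqinter> v\<close> and so below
    \<open>w\<close>; being below \<open>t\<close> it is also below \<open>olcompl L w\<close>. It
    is used for \<open>v = y\<close> and \<open>v = z\<close>.\<close>
  have t_orth: "t \<sqsubseteq> olcompl L v" if [simp]: "v \<in> carrier L" and "x \<sqinter> v \<sqsubseteq> w" for v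
  proof (rule orth)
    have le: "v \<sqinter> t \<sqsubseteq> t" "v \<sqinter> t \<sqsubseteq> v"
      by (simp_all add: meet_left meet_right)
    have "v \<sqinter> t \<sqsubseteq> x \<sqinter> v"
      by (rule meet_le) (use le t_le in \<open>auto intro: le_trans\<close>)
    then have "v \<sqinter> t \<sqsubseteq> w"
      using \<open>x \<sqinter> v \<sqsubseteq> w\<close> by (rule le_trans) simp_all
    moreover have "v \<sqinter> t \<sqsubseteq> olcompl L w"
      using le(1) t_le(1) by (rule le_trans) simp_all
    ultimately show "v \<sqinter> t = \<bottom>"
      by (intro bot[of _ w]) simp_all
  qed simp_all
  have "y \<squnion> z \<sqsubseteq> olcompl L t"
    using t_orth[of y] t_orth[of z] le_olcompl_iff[of t] join_left[of "x \<sqinter> y" "x \<sqinter> z"]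
      join_right[of "x \<sqinter> y" "x \<sqinter> z"]
    by (intro join_le) (simp_all add: w_def)
  then have "t = \<bottom>"
    using t_le(3) le_olcompl_iff[of t "y \<squnion> z"] by (intro bot[of _ "y \<squnion> z"]) simp_all
  \<comment> \<open>The hypothesis is used a second time: \<open>t = \<bottom>\<close> says that
    \<open>olcompl L w\<close> and \<open>x \<sqinter> (y \<squnion> z)\<close> are disjoint, so the
    latter lies below the double complement of \<open>w\<close>.\<close>
  then have "x \<sqinter> (y \<squnion> z) \<sqsubseteq> w"
    using orth[of "olcompl L w" "x \<sqinter> (y \<squnion> z)"] by (simp add: t_def)
  \<comment> \<open>This half of distributivity holds in every lattice.\<close>
  moreover have "w \<sqsubseteq> x \<sqinter> (y \<squnion> z)"
    unfolding w_def
    by (intro join_le meet_le)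
      (auto intro: meet_left meet_right join_left join_right
        le_trans[OF meet_right join_left] le_trans[OF meet_right join_right])
  ultimately show "x \<sqinter> (y \<squnion> z) = (x \<sqinter> y) \<squnion> (x \<sqinter> z)"
    unfolding w_def[symmetric] by (rule le_antisym) simp_all
qed (simp_all add: olmeet_eq_meet oljoin_eq_join olbot_eq_bottom oltop_eq_top join_olcompl_eq_top
    meet_olcompl_eq_bottom)

theorem boolean_iff_disjoint_orthogonal:
  "boolean_ortholattice L \<longleftrightarrow>
    (\<forall>x \<in> carrier L. \<forall>y \<in> carrier L. olmeet L x y = olbot L \<longrightarrow> y \<sqsubseteq> olcompl L x)"
  using boolean_imp_disjoint_orthogonal disjoint_orthogonal_imp_boolean
  by (auto simp: olmeet_eq_meet olbot_eq_bottom)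

end

section \<open>Zero arrows and orthogonality\<close>

definition arrs_into :: "('o, 'm, 'z) dagger_cat_scheme \<Rightarrow> 'o \<Rightarrow> 'm set" where
  "arrs_into C X = {g \<in> Arr C. Cod C g = X}"

definition polar :: "('o, 'm, 'z) dagger_cat_scheme \<Rightarrow> 'o \<Rightarrow> 'm set \<Rightarrow> 'm set" where
  "polar C X S =
     {g \<in> arrs_into C X. \<forall>f \<in> S. Dag C f \<cdot>\<^bsub>C\<^esub> g = zero_arr C (Dom C g) (Dom C f)}"

text \<open>The principal sieve generated by \<open>m\<close>. It does not change when
  \<open>m\<close> is precomposed with an isomorphism, so it is an invariant of the
  subobject.\<close>

definition sieve :: "('o, 'm, 'z) dagger_cat_scheme \<Rightarrow> 'm \<Rightarrow> 'm set" where
  "sieve C m = {g \<in> arrs_into C (Cod C m). \<exists>h \<in> Hom C (Dom C g) (Dom C m). g = m \<cdot>\<^bsub>C\<^esub> h}"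

text \<open>Plain monicity instead of \<open>dagger_mono\<close>, since \<open>kernel_of\<close>
  only determines a kernel up to isomorphism of its domain.\<close>

definition mono_arr :: "('o, 'm, 'z) dagger_cat_scheme \<Rightarrow> 'm \<Rightarrow> bool" where
  "mono_arr C m \<longleftrightarrow> m \<in> Arr C \<and>
     (\<forall>Z. \<forall>h \<in> Hom C Z (Dom C m). \<forall>h' \<in> Hom C Z (Dom C m).
        m \<cdot>\<^bsub>C\<^esub> h = m \<cdot>\<^bsub>C\<^esub> h' \<longrightarrow> h = h')"

lemma Hom_iff: "f \<in> Hom C X Y \<longleftrightarrow> f \<in> Arr C \<and> Dom C f = X \<and> Cod C f = Y"
  by (simp add: Hom_def)

lemma mono_arrI:
  assumes "m \<in> Hom C A X"
    and "\<And>Z h h'. \<lbrakk>h \<in> Hom C Z A; h' \<in> Hom C Z A; m \<cdot>\<^bsub>C\<^esub> h = m \<cdot>\<^bsub>C\<^esub> h'\<rbrakk> \<Longrightarrow> h = h'"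
  shows "mono_arr C m"
proof -
  have "m \<in> Arr C" "Dom C m = A"
    using assms(1) by (simp_all add: Hom_iff)
  then show ?thesis
    using assms(2) unfolding mono_arr_def by blast
qed

lemma polar_antitone: "S \<subseteq> T \<Longrightarrow> polar C X T \<subseteq> polar C X S"
  by (auto simp: polar_def)

context dagger_category
begin

lemma Hom_Obj: "f \<in> Hom C X Y \<Longrightarrow> X \<in> Obj C" "f \<in> Hom C X Y \<Longrightarrow> Y \<in> Obj C"
  using Dom_Obj Cod_Obj by (auto simp: Hom_iff)

lemma sieve_iff:
  assumes "m \<in> Hom C A X"
  shows "g \<in> sieve C m \<longleftrightarrow> g \<in> arrs_into C X \<and> (\<exists>h \<in> Hom C (Dom C g) A. g = m \<cdot> h)"
  using assms by (simp add: sieve_def Hom_iff)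

lemma comp_in_sieve:
  assumes "m \<in> Hom C A X" "h \<in> Hom C B A"
  shows "m \<cdot> h \<in> sieve C m"
  using Comp_Hom[OF assms(2,1)] assms
  by (auto simp: sieve_iff[OF assms(1)] arrs_into_def Hom_iff)

lemma self_in_sieve:
  assumes "m \<in> Arr C"
  shows "m \<in> sieve C m"
proof -
  have m: "m \<in> Hom C (Dom C m) (Cod C m)"
    using assms by (simp add: Hom_iff)
  show ?thesis
    using comp_in_sieve[OF m Id_Hom] Comp_Id[OF m] Dom_Obj[OF assms] by simp
qed

text \<open>As in the Yoneda lemma, everything is decided by the generator: \<open>m\<close> lies in
  its own sieve, and a factorization of \<open>m\<close> through \<open>n\<close> extends to all
  composites \<open>m \<cdot> h\<close>. The order of subobjects thus becomes inclusion.\<close>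

lemma sieve_subset_iff:
  assumes m: "m \<in> Hom C A X" and n: "n \<in> Hom C B X"
  shows "sieve C m \<subseteq> sieve C n \<longleftrightarrow> (\<exists>\<phi> \<in> Hom C A B. m = n \<cdot> \<phi>)"
proof
  assume "sieve C m \<subseteq> sieve C n"
  then have "m \<in> sieve C n"
    using self_in_sieve m by (auto simp: Hom_iff)
  then show "\<exists>\<phi> \<in> Hom C A B. m = n \<cdot> \<phi>"
    using m by (auto simp: sieve_iff[OF n] Hom_iff)
next
  assume "\<exists>\<phi> \<in> Hom C A B. m = n \<cdot> \<phi>"
  then obtain \<phi> where \<phi>: "\<phi> \<in> Hom C A B" "m = n \<cdot> \<phi>" by blast
  show "sieve C m \<subseteq> sieve C n"
  proof
    fix g assume "g \<in> sieve C m"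
    then obtain h where h: "h \<in> Hom C (Dom C g) A" "g = m \<cdot> h"
      by (auto simp: sieve_iff[OF m])
    then have "g = n \<cdot> (\<phi> \<cdot> h)"
      using \<phi> n by (simp add: Comp_assoc)
    then show "g \<in> sieve C n"
      using comp_in_sieve[OF n Comp_Hom[OF h(1) \<phi>(1)]] by simp
  qed
qed

end

context dagger_kernel_category
begin

section \<open>Calculus of zero arrows\<close>

lemma zero_object_zero_obj: "zero_object C (zero_obj C)"
  unfolding zero_obj_def by (rule someI_ex[OF zero_object_exists])

lemma zero_obj_Obj: "zero_obj C \<in> Obj C"
  using zero_object_zero_obj by (simp add: zero_object_def)

lemma ex1_to_zero: "X \<in> Obj C \<Longrightarrow> \<exists>!f. f \<in> Hom C X (zero_obj C)"
  and ex1_from_zero: "X \<in> Obj C \<Longrightarrow> \<exists>!f. f \<in> Hom C (zero_obj C) X"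
  using zero_object_zero_obj by (simp_all add: zero_object_def)

text \<open>Arrows to and from the zero object are unique, so the definite description in
  \<open>zero_arr\<close> has one candidate, and any factorization through the zero object computes
  it.\<close>

lemma zero_arr_eq:
  assumes g: "g \<in> Hom C X (zero_obj C)" and h: "h \<in> Hom C (zero_obj C) Y"
  shows "zero_arr C X Y = h \<cdot> g"
  unfolding zero_arr_def
proof (rule the_equality)
  show "\<exists>g' \<in> Hom C X (zero_obj C). \<exists>h' \<in> Hom C (zero_obj C) Y. h \<cdot> g = h' \<cdot> g'"
    using g h by blast
next
  fix f assume "\<exists>g' \<in> Hom C X (zero_obj C). \<exists>h' \<in> Hom C (zero_obj C) Y. f = h' \<cdot> g'"
  then show "f = h \<cdot> g"
    using g h ex1_to_zero[OF Hom_Obj(1)[OF g]] ex1_from_zero[OF Hom_Obj(2)[OF h]] by blast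
qed

lemma zero_arr_factors:
  assumes "X \<in> Obj C" "Y \<in> Obj C"
  obtains g h where "g \<in> Hom C X (zero_obj C)" "h \<in> Hom C (zero_obj C) Y" "zero_arr C X Y = h \<cdot> g"
  using ex1_to_zero[OF assms(1)] ex1_from_zero[OF assms(2)] zero_arr_eq by blast

lemma zero_arr_Hom: "\<lbrakk>X \<in> Obj C; Y \<in> Obj C\<rbrakk> \<Longrightarrow> zero_arr C X Y \<in> Hom C X Y"
  by (metis zero_arr_factors Comp_Hom)

lemma comp_zero_arr:
  assumes "X \<in> Obj C" and f: "f \<in> Hom C Y Z"
  shows "f \<cdot> zero_arr C X Y = zero_arr C X Z"
proof -
  obtain g h where gh: "g \<in> Hom C X (zero_obj C)" "h \<in> Hom C (zero_obj C) Y"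
      "zero_arr C X Y = h \<cdot> g"
    using zero_arr_factors assms(1) Hom_Obj(1)[OF f] by blast
  then show ?thesis
    using zero_arr_eq[OF gh(1) Comp_Hom[OF gh(2) f]] f by (simp add: Comp_assoc)
qed

lemma zero_arr_comp:
  assumes f: "f \<in> Hom C X Y" and "Z \<in> Obj C"
  shows "zero_arr C Y Z \<cdot> f = zero_arr C X Z"
proof -
  obtain g h where gh: "g \<in> Hom C Y (zero_obj C)" "h \<in> Hom C (zero_obj C) Z"
      "zero_arr C Y Z = h \<cdot> g"
    using zero_arr_factors assms(2) Hom_Obj(2)[OF f] by blast
  then show ?thesis
    using zero_arr_eq[OF Comp_Hom[OF f gh(1)] gh(2)] f by (simp add: Comp_assoc)
qed

lemma Dag_zero_arr:
  assumes "X \<in> Obj C" "Y \<in> Obj C"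
  shows "Dag C (zero_arr C X Y) = zero_arr C Y X"
proof -
  obtain g h where gh: "g \<in> Hom C X (zero_obj C)" "h \<in> Hom C (zero_obj C) Y"
      "zero_arr C X Y = h \<cdot> g"
    using zero_arr_factors assms by blast
  then show ?thesis
    using zero_arr_eq[OF Dag_Hom[OF gh(2)] Dag_Hom[OF gh(1)]] by (simp add: Dag_Comp)
qed

section \<open>Orthogonality and its Galois connection\<close>

text \<open>Take daggers of both sides. Symmetry of the relation is what makes the polar a Galois
  connection with itself, hence the double polar a closure operator.\<close>

lemma orthogonal_sym:
  assumes f: "f \<in> Hom C A X" and g: "g \<in> Hom C B X" and "Dag C f \<cdot> g = zero_arr C B A"
  shows "Dag C g \<cdot> f = zero_arr C A B"
proof -
  have "Dag C g \<cdot> f = Dag C (Dag C f \<cdot> g)"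
    using Dag_Comp[OF g Dag_Hom[OF f]] Dag_Dag f by (simp add: Hom_iff)
  then show ?thesis
    using assms Dag_zero_arr Hom_Obj by metis
qed

lemma subset_polar_polar:
  assumes "S \<subseteq> arrs_into C X"
  shows "S \<subseteq> polar C X (polar C X S)"
  using assms orthogonal_sym by (fastforce simp: polar_def arrs_into_def Hom_iff)

lemma polar_polar_polar:
  assumes "S \<subseteq> arrs_into C X"
  shows "polar C X (polar C X (polar C X S)) = polar C X S"
proof
  show "polar C X (polar C X (polar C X S)) \<subseteq> polar C X S"
    using assms by (intro polar_antitone subset_polar_polar)
  show "polar C X S \<subseteq> polar C X (polar C X (polar C X S))"
    by (intro subset_polar_polar) (auto simp: polar_def)
qed

text \<open>Orthogonality to a sieve need only be tested on the generator, because
  \<open>Dag C (m \<cdot> h) \<cdot> g\<close> equals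
  \<open>Dag C h \<cdot> (Dag C m \<cdot> g)\<close>.\<close>

lemma polar_sieve_iff:
  assumes m: "m \<in> Hom C A X"
  shows "g \<in> polar C X (sieve C m) \<longleftrightarrow>
    g \<in> arrs_into C X \<and> Dag C m \<cdot> g = zero_arr C (Dom C g) A"
proof
  assume "g \<in> polar C X (sieve C m)"
  then show "g \<in> arrs_into C X \<and> Dag C m \<cdot> g = zero_arr C (Dom C g) A"
    using self_in_sieve[of m] m by (auto simp: polar_def Hom_iff)
next
  assume g: "g \<in> arrs_into C X \<and> Dag C m \<cdot> g = zero_arr C (Dom C g) A"
  then have gH: "g \<in> Hom C (Dom C g) X"
    by (simp add: arrs_into_def Hom_iff)
  have "Dag C f \<cdot> g = zero_arr C (Dom C g) (Dom C f)" if f: "f \<in> sieve C m" for f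
  proof -
    obtain h where h: "h \<in> Hom C (Dom C f) A" "f = m \<cdot> h"
      using f by (auto simp: sieve_iff[OF m])
    have "Dag C f \<cdot> g = Dag C h \<cdot> (Dag C m \<cdot> g)"
      using h m gH Comp_assoc[OF gH Dag_Hom[OF m] Dag_Hom[OF h(1)]] by (simp add: Dag_Comp)
    also have "\<dots> = zero_arr C (Dom C g) (Dom C f)"
      using g comp_zero_arr[OF Hom_Obj(1)[OF gH] Dag_Hom[OF h(1)]] by simp
    finally show ?thesis .
  qed
  then show "g \<in> polar C X (sieve C m)"
    using g by (simp add: polar_def)
qed

section \<open>Kernels as closed sieves\<close>

text \<open>Both \<open>h\<close> and \<open>h'\<close> factor the same arrow
  \<open>k \<cdot> h\<close> through \<open>k\<close>, and \<open>f\<close> sends that arrow to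
  zero; uniqueness in the universal property identifies them.\<close>

lemma kernel_of_mono:
  assumes "kernel_of C f k"
  shows "mono_arr C k"
  unfolding mono_arr_def
proof (intro conjI allI ballI impI)
  show kA: "k \<in> Arr C"
    using assms by (simp add: kernel_of_def)
  fix Z h h'
  assume h: "h \<in> Hom C Z (Dom C k)" and h': "h' \<in> Hom C Z (Dom C k)" and eq: "k \<cdot> h = k \<cdot> h'"
  have f: "f \<in> Hom C (Dom C f) (Cod C f)" and k: "k \<in> Hom C (Dom C k) (Dom C f)"
    and fk: "f \<cdot> k = zero_arr C (Dom C k) (Cod C f)"
    using assms by (auto simp: kernel_of_def Hom_iff)
  have "f \<cdot> (k \<cdot> h) = zero_arr C Z (Cod C f)"
    using Comp_assoc[OF h k f] fk zero_arr_comp[OF h Hom_Obj(2)[OF f]] by simp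
  then have "\<exists>!u. u \<in> Hom C Z (Dom C k) \<and> k \<cdot> u = k \<cdot> h"
    using assms Comp_Hom[OF h k] Hom_Obj(1)[OF h] by (auto simp: kernel_of_def)
  then show "h = h'"
    using h h' eq by metis
qed

text \<open>The existence half of the universal property says that the sieve of \<open>k\<close> is
  the set of arrows annihilated by \<open>f\<close>; monicity supplies the uniqueness half.\<close>

lemma kernel_of_sieve:
  assumes k: "k \<in> Hom C K X" and f: "f \<in> Hom C X Y" and mono: "mono_arr C k"
  shows "kernel_of C f k \<longleftrightarrow> sieve C k = {g \<in> arrs_into C X. f \<cdot> g = zero_arr C (Dom C g) Y}"
    (is "_ \<longleftrightarrow> _ = ?N")
proof
  assume ker: "kernel_of C f k"
  have kD: "Dom C k = K" "Cod C k = X" and fD: "Dom C f = X" "Cod C f = Y"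
    using k f by (auto simp: Hom_iff)
  have fk: "f \<cdot> k = zero_arr C K Y"
    using ker by (simp add: kernel_of_def kD fD)
  show "sieve C k = ?N"
  proof (intro equalityI subsetI)
    fix g assume g: "g \<in> sieve C k"
    then obtain h where h: "h \<in> Hom C (Dom C g) K" "g = k \<cdot> h"
      by (auto simp: sieve_iff[OF k])
    then have "f \<cdot> g = zero_arr C (Dom C g) Y"
      using Comp_assoc[OF h(1) k f] fk zero_arr_comp[OF h(1) Hom_Obj(2)[OF f]] by simp
    then show "g \<in> ?N"
      using g by (simp add: sieve_iff[OF k])
  next
    fix g assume g: "g \<in> ?N"
    then have "g \<in> Hom C (Dom C g) X" "Dom C g \<in> Obj C"
      by (auto simp: arrs_into_def Hom_iff Dom_Obj)
    then have "\<exists>!h. h \<in> Hom C (Dom C g) K \<and> k \<cdot> h = g"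
      using ker g by (simp add: kernel_of_def kD fD)
    then show "g \<in> sieve C k"
      using g by (auto simp: sieve_iff[OF k])
  qed
next
  assume eq: "sieve C k = ?N"
  have kD: "k \<in> Arr C" "Dom C k = K" "Cod C k = X" and fD: "f \<in> Arr C" "Dom C f = X" "Cod C f = Y"
    using k f by (auto simp: Hom_iff)
  have "f \<cdot> k = zero_arr C K Y"
    using self_in_sieve[OF kD(1)] eq kD by simp
  moreover have "\<exists>!h. h \<in> Hom C Z K \<and> k \<cdot> h = g"
    if g: "g \<in> Hom C Z X" and fg: "f \<cdot> g = zero_arr C Z Y" for Z g
  proof -
    have "g \<in> sieve C k"
      using g fg eq by (simp add: arrs_into_def Hom_iff)
    then obtain h where "h \<in> Hom C Z K" "k \<cdot> h = g"
      using g by (auto simp: sieve_iff[OF k] Hom_iff)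
    then show ?thesis
      using mono by (auto simp: mono_arr_def kD)
  qed
  ultimately show "kernel_of C f k"
    by (simp add: kernel_of_def kD fD)
qed

lemma ker_props:
  assumes "f \<in> Hom C X Y"
  shows "kernel_of C f (ker C f)" "dagger_mono C (ker C f)"
    "ker C f \<in> Hom C (Dom C (ker C f)) X"
proof -
  have "f \<in> Arr C"
    using assms by (simp add: Hom_iff)
  then have "kernel_of C f (ker C f) \<and> dagger_mono C (ker C f)"
    unfolding ker_def by (rule someI_ex[OF dagger_kernel_exists])
  then show "kernel_of C f (ker C f)" "dagger_mono C (ker C f)"
    "ker C f \<in> Hom C (Dom C (ker C f)) X"
    using assms by (auto simp: kernel_of_def Hom_iff)
qed

lemma kernels_into_iff: "m \<in> kernels_into C X \<longleftrightarrow> (\<exists>f. kernel_of C f m) \<and> m \<in> Hom C (Dom C m) X"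
  by (auto simp: kernels_into_def is_kernel_def Hom_iff kernel_of_def)

lemma kernels_into_mono: "m \<in> kernels_into C X \<Longrightarrow> mono_arr C m"
  using kernel_of_mono by (auto simp: kernels_into_iff)

lemma perp_kernel:
  assumes "m \<in> Hom C A X"
  shows "perp C m \<in> kernels_into C X"
  using ker_props[OF Dag_Hom[OF assms]] by (auto simp: perp_def kernels_into_iff)

text \<open>Both sides are the set of arrows annihilated by \<open>Dag C m\<close>: the left one
  because \<open>perp C m\<close> is a kernel of it, the right one by
  \<open>polar_sieve_iff\<close>.\<close>

lemma sieve_perp:
  assumes m: "m \<in> Hom C A X"
  shows "sieve C (perp C m) = polar C X (sieve C m)"
proof -
  have "sieve C (perp C m) = {g \<in> arrs_into C X. Dag C m \<cdot> g = zero_arr C (Dom C g) A}"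
    using ker_props[OF Dag_Hom[OF m]] kernel_of_mono
      kernel_of_sieve[OF _ Dag_Hom[OF m]] unfolding perp_def by blast
  then show ?thesis
    using polar_sieve_iff[OF m] by blast
qed

lemma sieve_subset_arrs_into: "m \<in> Hom C A X \<Longrightarrow> sieve C m \<subseteq> arrs_into C X"
  by (auto simp: sieve_iff)

text \<open>A criterion that no longer mentions the arrow of which \<open>m\<close> is a kernel. If
  \<open>m\<close> is a kernel of \<open>f\<close>, its sieve is the polar of
  \<open>{Dag C f}\<close>, and polars are closed. Conversely a closed sieve is the polar of the
  sieve of \<open>perp C m\<close>, so \<open>m\<close> is a kernel of
  \<open>Dag C (perp C m)\<close>.\<close>

lemma kernels_into_iff_closed:
  assumes m: "m \<in> Hom C A X"
  shows "m \<in> kernels_into C X \<longleftrightarrow>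
    mono_arr C m \<and> polar C X (polar C X (sieve C m)) = sieve C m"
proof
  assume mk: "m \<in> kernels_into C X"
  then obtain f where f: "kernel_of C f m"
    by (auto simp: kernels_into_iff)
  then have fH: "f \<in> Hom C X (Cod C f)"
    using m by (auto simp: kernel_of_def Hom_iff)
  have mono: "mono_arr C m"
    using mk by (rule kernels_into_mono)
  have "sieve C m = {g \<in> arrs_into C X. f \<cdot> g = zero_arr C (Dom C g) (Cod C f)}"
    using kernel_of_sieve[OF m fH mono] f by simp
  also have "\<dots> = polar C X {Dag C f}"
    using Dag_Hom[OF fH] Dag_Dag[of f] fH by (auto simp: polar_def Hom_iff)
  finally have "sieve C m = polar C X {Dag C f}" .
  moreover have "{Dag C f} \<subseteq> arrs_into C X"
    using Dag_Hom[OF fH] by (simp add: arrs_into_def Hom_iff)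
  ultimately show "mono_arr C m \<and> polar C X (polar C X (sieve C m)) = sieve C m"
    using mono polar_polar_polar by metis
next
  assume cl: "mono_arr C m \<and> polar C X (polar C X (sieve C m)) = sieve C m"
  define p where "p = perp C m"
  have p: "p \<in> Hom C (Dom C p) X"
    using perp_kernel[OF m] by (simp add: p_def kernels_into_iff)
  have "sieve C m = polar C X (sieve C p)"
    using cl sieve_perp[OF m] by (simp add: p_def)
  then have "sieve C m = {g \<in> arrs_into C X. Dag C p \<cdot> g = zero_arr C (Dom C g) (Dom C p)}"
    using polar_sieve_iff[OF p] by blast
  then have "kernel_of C (Dag C p) m"
    using kernel_of_sieve[OF m Dag_Hom[OF p]] cl by simp
  then show "m \<in> kernels_into C X"
    using m by (auto simp: kernels_into_iff Hom_iff)
qed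

section \<open>Only zero arrows are self-orthogonal\<close>

text \<open>Being orthogonal to itself, \<open>f\<close> factors as \<open>k \<cdot> h\<close>
  through \<open>k = perp C f\<close>. As \<open>k\<close> is a dagger mono,
  \<open>h = Dag C k \<cdot> f\<close>, and this is zero because \<open>k\<close> is orthogonal to
  \<open>f\<close>.\<close>

lemma self_orthogonal_zero:
  assumes f: "f \<in> Hom C A X" and orth: "Dag C f \<cdot> f = zero_arr C A A"
  shows "f = zero_arr C A X"
proof -
  define k where "k = perp C f"
  define K where "K = Dom C k"
  have k: "k \<in> Hom C K X" and dm: "Dag C k \<cdot> k = Id C K"
    using ker_props[OF Dag_Hom[OF f]] by (auto simp: k_def K_def perp_def dagger_mono_def)
  have sk: "sieve C k = polar C X (sieve C f)"
    using sieve_perp[OF f] by (simp add: k_def)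
  have "f \<in> sieve C k" "k \<in> sieve C k"
    using orth f k self_in_sieve sk polar_sieve_iff[OF f]
    by (auto simp: arrs_into_def Hom_iff)
  then obtain h where h: "h \<in> Hom C A K" "f = k \<cdot> h"
    using f by (auto simp: sieve_iff[OF k] Hom_iff)
  have "Dag C f \<cdot> k = zero_arr C K A"
    using \<open>k \<in> sieve C k\<close> sk polar_sieve_iff[OF f] k by (auto simp: Hom_iff)
  then have "Dag C k \<cdot> f = zero_arr C A K"
    using orthogonal_sym[OF f k] by simp
  moreover have "Dag C k \<cdot> f = h"
    using h dm Comp_assoc[OF h(1) k Dag_Hom[OF k]] Id_Comp[OF h(1)] by simp
  ultimately show ?thesis
    using h comp_zero_arr[OF Hom_Obj(1)[OF f] k] by simp
qed

lemma inter_polar: "S \<inter> polar C X S \<subseteq> {g \<in> arrs_into C X. g = zero_arr C (Dom C g) X}"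
proof
  fix g assume "g \<in> S \<inter> polar C X S"
  then have g: "g \<in> arrs_into C X" and "Dag C g \<cdot> g = zero_arr C (Dom C g) (Dom C g)"
    by (simp_all add: polar_def)
  then have "g = zero_arr C (Dom C g) X"
    using self_orthogonal_zero[of g "Dom C g" X] by (simp add: arrs_into_def Hom_iff)
  then show "g \<in> {g \<in> arrs_into C X. g = zero_arr C (Dom C g) X}"
    using g by blast
qed

section \<open>The ortholattice of kernel subobjects\<close>

lemma sieve_pullback:
  assumes "pullback C m n p q" and m: "m \<in> Hom C A X" and n: "n \<in> Hom C B X"
  shows "sieve C (m \<cdot> p) = sieve C m \<inter> sieve C n"
proof -
  have p: "p \<in> Hom C (Dom C p) A" and q: "q \<in> Hom C (Dom C p) B" and sq: "m \<cdot> p = n \<cdot> q"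
    and univ: "\<And>Z f g. \<lbrakk>f \<in> Hom C Z A; g \<in> Hom C Z B; m \<cdot> f = n \<cdot> g\<rbrakk>
      \<Longrightarrow> \<exists>!h. h \<in> Hom C Z (Dom C p) \<and> p \<cdot> h = f \<and> q \<cdot> h = g"
    using assms Hom_Obj by (auto simp: pullback_def Hom_iff)
  have mp: "m \<cdot> p \<in> Hom C (Dom C p) X"
    using Comp_Hom[OF p m] .
  show ?thesis
  proof (intro equalityI subsetI)
    fix g assume "g \<in> sieve C (m \<cdot> p)"
    then show "g \<in> sieve C m \<inter> sieve C n"
      using sieve_subset_iff[OF mp m] sieve_subset_iff[OF mp n] p q sq by blast
  next
    fix g assume g: "g \<in> sieve C m \<inter> sieve C n"
    then obtain a b where a: "a \<in> Hom C (Dom C g) A" "g = m \<cdot> a"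
      and b: "b \<in> Hom C (Dom C g) B" "g = n \<cdot> b"
      using sieve_iff[OF m] sieve_iff[OF n] by blast
    then obtain h where h: "h \<in> Hom C (Dom C g) (Dom C p)" "p \<cdot> h = a"
      using univ[OF a(1) b(1)] by auto
    then have "g = (m \<cdot> p) \<cdot> h"
      using Comp_assoc[OF h(1) p m] a by simp
    then show "g \<in> sieve C (m \<cdot> p)"
      using comp_in_sieve[OF mp h(1)] by simp
  qed
qed

text \<open>Monic: an arrow into the corner is determined by its composites with \<open>p\<close>
  and \<open>q\<close>, and these are determined since \<open>m\<close> and \<open>n\<close> are
  monic. Closed: the double polar of the intersection lies in each of the two closed sieves.\<close>

lemma kernel_pullback:
  assumes pb: "pullback C m n p q" and m: "m \<in> kernels_into C X" and n: "n \<in> kernels_into C X"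
  shows "m \<cdot> p \<in> kernels_into C X"
proof -
  define P where "P = Dom C p"
  have mH: "m \<in> Hom C (Dom C m) X" and nH: "n \<in> Hom C (Dom C n) X"
    using m n by (simp_all add: kernels_into_iff)
  have p: "p \<in> Hom C P (Dom C m)" and q: "q \<in> Hom C P (Dom C n)" and sq: "m \<cdot> p = n \<cdot> q"
    and univ: "\<And>Z f g. \<lbrakk>f \<in> Hom C Z (Dom C m); g \<in> Hom C Z (Dom C n); m \<cdot> f = n \<cdot> g\<rbrakk>
      \<Longrightarrow> \<exists>!h. h \<in> Hom C Z P \<and> p \<cdot> h = f \<and> q \<cdot> h = g"
    using pb Hom_Obj by (auto simp: pullback_def P_def)
  have mp: "m \<cdot> p \<in> Hom C P X"
    using Comp_Hom[OF p mH] .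
  have "h = h'" if h: "h \<in> Hom C Z P" and h': "h' \<in> Hom C Z P"
    and eq: "(m \<cdot> p) \<cdot> h = (m \<cdot> p) \<cdot> h'" for Z h h'
  proof -
    have "m \<cdot> (p \<cdot> h) = m \<cdot> (p \<cdot> h')" "n \<cdot> (q \<cdot> h) = n \<cdot> (q \<cdot> h')" "m \<cdot> (p \<cdot> h) = n \<cdot> (q \<cdot> h)"
      using eq sq Comp_assoc[OF h p mH] Comp_assoc[OF h' p mH]
        Comp_assoc[OF h q nH] Comp_assoc[OF h' q nH] by simp_all
    moreover from this have "p \<cdot> h = p \<cdot> h'" "q \<cdot> h = q \<cdot> h'"
      using kernels_into_mono[OF m] kernels_into_mono[OF n]
        Comp_Hom[OF h p] Comp_Hom[OF h' p] Comp_Hom[OF h q] Comp_Hom[OF h' q]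
      unfolding mono_arr_def by blast+
    ultimately show ?thesis
      using univ[OF Comp_Hom[OF h p] Comp_Hom[OF h q]] h h' by metis
  qed
  then have "mono_arr C (m \<cdot> p)"
    by (rule mono_arrI[OF mp])
  moreover have "polar C X (polar C X (sieve C (m \<cdot> p))) = sieve C (m \<cdot> p)"
  proof
    show "sieve C (m \<cdot> p) \<subseteq> polar C X (polar C X (sieve C (m \<cdot> p)))"
      using subset_polar_polar[OF sieve_subset_arrs_into[OF mp]] .
    have "polar C X (polar C X (sieve C m \<inter> sieve C n)) \<subseteq> sieve C m"
      "polar C X (polar C X (sieve C m \<inter> sieve C n)) \<subseteq> sieve C n"
      using m n kernels_into_iff_closed[OF mH] kernels_into_iff_closed[OF nH]
        polar_antitone[OF polar_antitone[OF Int_lower1]]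
        polar_antitone[OF polar_antitone[OF Int_lower2]] by metis+
    then show "polar C X (polar C X (sieve C (m \<cdot> p))) \<subseteq> sieve C (m \<cdot> p)"
      using sieve_pullback[OF pb mH nH] by simp
  qed
  ultimately show ?thesis
    using kernels_into_iff_closed[OF mp] by simp
qed

text \<open>If \<open>n\<close> is a kernel of \<open>g\<close>, its pullback along \<open>m\<close>
  is a kernel of \<open>g \<cdot> m\<close>; the other leg \<open>q\<close> is the factorization of
  \<open>m \<cdot> p\<close> through \<open>n\<close>.\<close>

lemma pullback_exists:
  assumes m: "m \<in> kernels_into C X" and n: "n \<in> kernels_into C X"
  shows "\<exists>p q. pullback C m n p q"
proof -
  define A where "A = Dom C m"
  define B where "B = Dom C n"
  have mH: "m \<in> Hom C A X" and nH: "n \<in> Hom C B X"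
    using m n by (simp_all add: kernels_into_iff A_def B_def)
  obtain g where g: "kernel_of C g n"
    using n by (auto simp: kernels_into_iff)
  define Y where "Y = Cod C g"
  have gH: "g \<in> Hom C X Y"
    using g nH by (auto simp: kernel_of_def Hom_iff Y_def)
  have sn: "sieve C n = {a \<in> arrs_into C X. g \<cdot> a = zero_arr C (Dom C a) Y}"
    using kernel_of_sieve[OF nH gH kernels_into_mono[OF n]] g by simp
  have gm: "g \<cdot> m \<in> Hom C A Y"
    using Comp_Hom[OF mH gH] .
  define p where "p = ker C (g \<cdot> m)"
  define P where "P = Dom C p"
  have p: "p \<in> Hom C P A" and kp: "kernel_of C (g \<cdot> m) p"
    using ker_props[OF gm] by (simp_all add: p_def P_def)
  have sp: "sieve C p = {a \<in> arrs_into C A. (g \<cdot> m) \<cdot> a = zero_arr C (Dom C a) Y}"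
    using kernel_of_sieve[OF p gm kernel_of_mono[OF kp]] kp by simp
  have "p \<in> sieve C p"
    using self_in_sieve p by (simp add: Hom_iff)
  then have "m \<cdot> p \<in> sieve C n"
    using sn sp Comp_assoc[OF p mH gH] Comp_Hom[OF p mH] p by (simp add: arrs_into_def Hom_iff)
  then obtain q where q: "q \<in> Hom C P B" "m \<cdot> p = n \<cdot> q"
    using Comp_Hom[OF p mH] by (auto simp: sieve_iff[OF nH] Hom_iff)
  have "\<exists>!h. h \<in> Hom C Z P \<and> p \<cdot> h = a \<and> q \<cdot> h = b"
    if a: "a \<in> Hom C Z A" and b: "b \<in> Hom C Z B" and ab: "m \<cdot> a = n \<cdot> b" for Z a b
  proof -
    have "m \<cdot> a \<in> sieve C n"
      using comp_in_sieve[OF nH b] ab by simp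
    then have "(g \<cdot> m) \<cdot> a = zero_arr C Z Y"
      using sn Comp_assoc[OF a mH gH] Comp_Hom[OF a mH] by (simp add: Hom_iff)
    then have "a \<in> sieve C p"
      using sp a by (simp add: arrs_into_def Hom_iff)
    then obtain h where h: "h \<in> Hom C Z P" "a = p \<cdot> h"
      using a by (auto simp: sieve_iff[OF p] Hom_iff)
    have "n \<cdot> (q \<cdot> h) = n \<cdot> b"
      using Comp_assoc[OF h(1) q(1) nH] Comp_assoc[OF h(1) p mH] q h ab by simp
    then have "q \<cdot> h = b"
      using kernels_into_mono[OF n] Comp_Hom[OF h(1) q(1)] b nH
      unfolding mono_arr_def B_def by blast
    moreover have "h' = h" if "h' \<in> Hom C Z P" "p \<cdot> h' = a" for h'
      using kernel_of_mono[OF kp] h that unfolding mono_arr_def P_def by blast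
    ultimately show ?thesis
      using h by blast
  qed
  moreover have "m \<in> Arr C" "n \<in> Arr C" "Cod C m = Cod C n"
    using mH nH by (simp_all add: Hom_iff)
  ultimately have "pullback C m n p q"
    using p q unfolding pullback_def A_def[symmetric] B_def[symmetric] P_def[symmetric] by blast
  then show ?thesis by blast
qed

section \<open>From isomorphism classes to sieves\<close>

text \<open>Equal sieves give factorizations in both directions. Kernels being monic, these are
  mutually inverse, so the comparison arrow is an isomorphism.\<close>

lemma ksub_rel_iff:
  "(m, n) \<in> ksub_rel C X \<longleftrightarrow>
    m \<in> kernels_into C X \<and> n \<in> kernels_into C X \<and> sieve C m = sieve C n"
proof (cases "m \<in> kernels_into C X \<and> n \<in> kernels_into C X")
  case True
  then have m: "m \<in> Hom C (Dom C m) X" and n: "n \<in> Hom C (Dom C n) X"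
    by (simp_all add: kernels_into_iff)
  have inverse: "\<psi> \<cdot> \<phi> = Id C (Dom C a)"
    if a: "a \<in> kernels_into C X" and \<phi>: "\<phi> \<in> Hom C (Dom C a) (Dom C b)" "a = b \<cdot> \<phi>"
      and \<psi>: "\<psi> \<in> Hom C (Dom C b) (Dom C a)" "b = a \<cdot> \<psi>" for a b \<phi> \<psi>
  proof -
    have aH: "a \<in> Hom C (Dom C a) X"
      using a by (simp add: kernels_into_iff)
    have "a \<cdot> (\<psi> \<cdot> \<phi>) = a \<cdot> Id C (Dom C a)"
      using Comp_assoc[OF \<phi>(1) \<psi>(1) aH] \<phi>(2) \<psi>(2) Comp_Id[OF aH] by metis
    then show ?thesis
      using kernels_into_mono[OF a] Comp_Hom[OF \<phi>(1) \<psi>(1)] Id_Hom[OF Hom_Obj(1)[OF aH]]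
      unfolding mono_arr_def by blast
  qed
  have "(\<exists>\<phi> \<in> Hom C (Dom C m) (Dom C n). iso_arr C \<phi> \<and> m = n \<cdot> \<phi>) \<longleftrightarrow> sieve C m = sieve C n"
  proof
    assume "\<exists>\<phi> \<in> Hom C (Dom C m) (Dom C n). iso_arr C \<phi> \<and> m = n \<cdot> \<phi>"
    then obtain \<phi> where \<phi>: "\<phi> \<in> Hom C (Dom C m) (Dom C n)" "m = n \<cdot> \<phi>" and "iso_arr C \<phi>"
      by blast
    then obtain \<psi> where \<psi>: "\<psi> \<in> Hom C (Dom C n) (Dom C m)" "\<phi> \<cdot> \<psi> = Id C (Dom C n)"
      unfolding iso_arr_def by (metis Hom_iff)
    have "n = m \<cdot> \<psi>"
      using Comp_assoc[OF \<psi>(1) \<phi>(1) n] \<psi>(2) \<phi>(2) Comp_Id[OF n] by simp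
    then show "sieve C m = sieve C n"
      using \<phi> \<psi> sieve_subset_iff[OF m n] sieve_subset_iff[OF n m] by blast
  next
    assume "sieve C m = sieve C n"
    then obtain \<phi> \<psi> where \<phi>: "\<phi> \<in> Hom C (Dom C m) (Dom C n)" "m = n \<cdot> \<phi>"
      and \<psi>: "\<psi> \<in> Hom C (Dom C n) (Dom C m)" "n = m \<cdot> \<psi>"
      using sieve_subset_iff[OF m n] sieve_subset_iff[OF n m] by blast
    then have "\<psi> \<cdot> \<phi> = Id C (Dom C m)" "\<phi> \<cdot> \<psi> = Id C (Dom C n)"
      using inverse[of m \<phi> n \<psi>] inverse[of n \<psi> m \<phi>] True by blast+
    then have "iso_arr C \<phi>"
      using \<phi>(1) \<psi>(1) unfolding iso_arr_def by (metis Hom_iff)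
    then show "\<exists>\<phi> \<in> Hom C (Dom C m) (Dom C n). iso_arr C \<phi> \<and> m = n \<cdot> \<phi>"
      using \<phi> by blast
  qed
  then show ?thesis
    using True by (simp add: ksub_rel_def)
qed (auto simp: ksub_rel_def)

lemma ksub_class_eq:
  assumes "m \<in> kernels_into C X"
  shows "ksub_class C m = {n \<in> kernels_into C X. sieve C n = sieve C m}"
proof -
  have "Cod C m = X"
    using assms by (simp add: kernels_into_def)
  then show ?thesis
    using assms by (auto simp: ksub_class_def ksub_rel_iff)
qed

lemma ksub_class_cong:
  "\<lbrakk>m \<in> kernels_into C X; n \<in> kernels_into C X; sieve C m = sieve C n\<rbrakk>
    \<Longrightarrow> ksub_class C m = ksub_class C n"
  by (simp add: ksub_class_eq)

lemma carrier_KSub: "carrier (KSub C X) = ksub_class C ` kernels_into C X"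
proof -
  have "ksub_rel C X `` {m} = ksub_class C m" if "m \<in> kernels_into C X" for m
    using that by (simp add: ksub_class_def kernels_into_def)
  then show ?thesis
    by (auto simp: KSub_def quotient_def)
qed

text \<open>\<open>ksub_le\<close> only asks for some pair of representatives, but all pairs have
  the same two sieves and so give the same answer.\<close>

lemma ksub_le_class:
  assumes m: "m \<in> kernels_into C X" and n: "n \<in> kernels_into C X"
  shows "ksub_le C (ksub_class C m) (ksub_class C n) \<longleftrightarrow> sieve C m \<subseteq> sieve C n"
proof -
  have *: "(\<exists>\<phi> \<in> Hom C (Dom C a) (Dom C b). a = b \<cdot> \<phi>) \<longleftrightarrow> sieve C m \<subseteq> sieve C n"
    if "a \<in> ksub_class C m" "b \<in> ksub_class C n" for a b
    using that sieve_subset_iff[of a "Dom C a" X b "Dom C b"]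
    by (auto simp: ksub_class_eq[OF m] ksub_class_eq[OF n] kernels_into_iff)
  have "m \<in> ksub_class C m" "n \<in> ksub_class C n"
    using m n by (simp_all add: ksub_class_eq)
  then show ?thesis
    unfolding ksub_le_def by (auto simp only: * cong: bex_cong)
qed

lemma ksub_perp_class:
  assumes m: "m \<in> kernels_into C X"
  shows "ksub_perp C (ksub_class C m) = ksub_class C (perp C m)"
proof -
  have "ksub_class C (perp C n) = ksub_class C (perp C m)" if "n \<in> ksub_class C m" for n
  proof -
    have n: "n \<in> kernels_into C X" "sieve C n = sieve C m"
      using that by (auto simp: ksub_class_eq[OF m])
    have H: "m \<in> Hom C (Dom C m) X" "n \<in> Hom C (Dom C n) X"
      using m n by (simp_all add: kernels_into_iff)
    show ?thesis
      using n(2) perp_kernel[OF H(1)] perp_kernel[OF H(2)] sieve_perp[OF H(1)] sieve_perp[OF H(2)]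
      by (intro ksub_class_cong[of _ X]) simp_all
  qed
  moreover have "m \<in> ksub_class C m"
    using m by (simp add: ksub_class_eq)
  ultimately show ?thesis
    unfolding ksub_perp_def by blast
qed

text \<open>Every pullback of representatives has the same sieve, so the union in
  \<open>ksub_meet\<close> runs over a single class; \<open>pullback_exists\<close> ensures that it
  is not empty. The representative \<open>k\<close> stays anonymous since only its sieve
  matters.\<close>

lemma ksub_meet_class:
  assumes m: "m \<in> kernels_into C X" and n: "n \<in> kernels_into C X"
  obtains k where "k \<in> kernels_into C X" "sieve C k = sieve C m \<inter> sieve C n"
    "ksub_meet C (ksub_class C m) (ksub_class C n) = ksub_class C k"
proof -
  have pb: "a \<cdot> p \<in> kernels_into C X \<and> sieve C (a \<cdot> p) = sieve C m \<inter> sieve C n"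
    if "a \<in> ksub_class C m" "b \<in> ksub_class C n" "pullback C a b p q" for a b p q
    using that kernel_pullback[of a b p q X] sieve_pullback[of a b p q "Dom C a" X "Dom C b"]
    by (auto simp: ksub_class_eq[OF m] ksub_class_eq[OF n] kernels_into_iff)
  have refl: "m \<in> ksub_class C m" "n \<in> ksub_class C n"
    using m n by (simp_all add: ksub_class_eq)
  obtain p q where pq: "pullback C m n p q"
    using pullback_exists[OF m n] by blast
  have k: "m \<cdot> p \<in> kernels_into C X" "sieve C (m \<cdot> p) = sieve C m \<inter> sieve C n"
    using pb[OF refl pq] by auto
  have "ksub_class C (a \<cdot> p') = ksub_class C (m \<cdot> p)"
    if "a \<in> ksub_class C m" "b \<in> ksub_class C n" "pullback C a b p' q'" for a b p' q'
    using pb[OF that] k by (intro ksub_class_cong[of _ X]) simp_all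
  then have "{ksub_class C (a \<cdot> p') | a b p' q'.
      a \<in> ksub_class C m \<and> b \<in> ksub_class C n \<and> pullback C a b p' q'} = {ksub_class C (m \<cdot> p)}"
    using refl pq by blast
  then have "ksub_meet C (ksub_class C m) (ksub_class C n) = ksub_class C (m \<cdot> p)"
    unfolding ksub_meet_def by simp
  with k that show thesis by blast
qed

section \<open>Top and bottom\<close>

lemma Id_kernel:
  assumes X: "X \<in> Obj C"
  shows "Id C X \<in> kernels_into C X" "sieve C (Id C X) = arrs_into C X"
proof -
  note I = Id_Hom[OF X]
  have s: "sieve C (Id C X) = arrs_into C X"
  proof (intro equalityI subsetI)
    fix g assume "g \<in> arrs_into C X"
    then have "g \<in> Hom C (Dom C g) X"
      by (simp add: arrs_into_def Hom_iff)
    then show "g \<in> sieve C (Id C X)"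
      using comp_in_sieve[OF I] Id_Comp by metis
  qed (simp add: sieve_iff[OF I])
  then show "sieve C (Id C X) = arrs_into C X" .
  have "h = h'" if "h \<in> Hom C Z X" "h' \<in> Hom C Z X" "Id C X \<cdot> h = Id C X \<cdot> h'" for Z h h'
    using that Id_Comp by metis
  then have "mono_arr C (Id C X)"
    by (rule mono_arrI[OF I])
  moreover have "polar C X (polar C X (arrs_into C X)) = arrs_into C X"
    using subset_polar_polar[of "arrs_into C X" X] by (auto simp: polar_def)
  ultimately show "Id C X \<in> kernels_into C X"
    using kernels_into_iff_closed[OF I] s by simp
qed

text \<open>The sieve consists of the zero arrows into \<open>X\<close>. These are the arrows
  annihilated by \<open>Id C X\<close>, so the zero arrow is a kernel of the identity.\<close>

lemma zero_kernel:
  assumes X: "X \<in> Obj C"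
  shows "zero_arr C (zero_obj C) X \<in> kernels_into C X"
    "sieve C (zero_arr C (zero_obj C) X) = {g \<in> arrs_into C X. g = zero_arr C (Dom C g) X}"
proof -
  let ?z = "zero_arr C (zero_obj C) X"
  note I = Id_Hom[OF X]
  have z: "?z \<in> Hom C (zero_obj C) X"
    using zero_arr_Hom[OF zero_obj_Obj X] .
  show s: "sieve C ?z = {g \<in> arrs_into C X. g = zero_arr C (Dom C g) X}"
  proof (intro equalityI subsetI)
    fix g assume g: "g \<in> sieve C ?z"
    then obtain h where h: "h \<in> Hom C (Dom C g) (zero_obj C)" "g = ?z \<cdot> h"
      unfolding sieve_iff[OF z] by blast
    have "g = zero_arr C (Dom C g) X"
      by (rule trans[OF h(2) zero_arr_comp[OF h(1) X]])
    then show "g \<in> {g \<in> arrs_into C X. g = zero_arr C (Dom C g) X}"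
      using g sieve_iff[OF z] by blast
  next
    fix g assume "g \<in> {g \<in> arrs_into C X. g = zero_arr C (Dom C g) X}"
    then have g: "g \<in> Arr C" "g = zero_arr C (Dom C g) X"
      unfolding arrs_into_def by blast+
    obtain h where h: "h \<in> Hom C (Dom C g) (zero_obj C)"
      using ex1_to_zero[OF Dom_Obj[OF g(1)]] by blast
    have "g = ?z \<cdot> h"
      by (rule trans[OF g(2) zero_arr_comp[OF h X, symmetric]])
    then show "g \<in> sieve C ?z"
      using comp_in_sieve[OF z h] by simp
  qed
  have "h = h'" if "h \<in> Hom C Z (zero_obj C)" "h' \<in> Hom C Z (zero_obj C)" for Z h h'
    using that ex1_to_zero Hom_Obj(1) by blast
  then have mono: "mono_arr C ?z"
    by (rule mono_arrI[OF z])
  have "{g \<in> arrs_into C X. g = zero_arr C (Dom C g) X} =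
      {g \<in> arrs_into C X. Id C X \<cdot> g = zero_arr C (Dom C g) X}"
    using Id_Comp by (auto simp: arrs_into_def Hom_iff)
  then have "kernel_of C (Id C X) ?z"
    using kernel_of_sieve[OF z I mono] s by simp
  then show "?z \<in> kernels_into C X"
    using z by (auto simp: kernels_into_iff Hom_iff)
qed

lemma zero_sieve_subset:
  assumes X: "X \<in> Obj C" and m: "m \<in> Hom C A X"
  shows "sieve C (zero_arr C (zero_obj C) X) \<subseteq> sieve C m"
proof -
  have "zero_arr C (zero_obj C) A \<in> Hom C (zero_obj C) A"
    using zero_arr_Hom zero_obj_Obj Hom_Obj(1)[OF m] by blast
  then show ?thesis
    using sieve_subset_iff[OF zero_arr_Hom[OF zero_obj_Obj X] m] comp_zero_arr[OF zero_obj_Obj m]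
    by metis
qed

lemma KSub_simps [simp]:
  "le (KSub C X) = ksub_le C" "eq (KSub C X) = (=)" "olmeet (KSub C X) = ksub_meet C"
  "oljoin (KSub C X) = ksub_join C" "olcompl (KSub C X) = ksub_perp C"
  "olbot (KSub C X) = ksub_bot C X" "oltop (KSub C X) = ksub_top C X"
  by (simp_all add: KSub_def)

section \<open>Ortholattice laws for kernel subobjects\<close>

text \<open>After representatives are chosen, each law becomes a statement about inclusions,
  intersections and polars of sieves.\<close>

lemma ortholattice_KSub:
  assumes X: "X \<in> Obj C"
  shows "ortholattice (KSub C X)"
proof -
  let ?L = "KSub C X"
  have rep: "\<exists>m \<in> kernels_into C X. A = ksub_class C m" if "A \<in> carrier ?L" for A
    using that by (auto simp: carrier_KSub)
  have cl: "ksub_class C m \<in> carrier ?L" if "m \<in> kernels_into C X" for m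
    using that by (simp add: carrier_KSub)
  have perp: "perp C m \<in> kernels_into C X" "sieve C (perp C m) = polar C X (sieve C m)"
    "polar C X (polar C X (sieve C m)) = sieve C m" if "m \<in> kernels_into C X" for m
    using that perp_kernel sieve_perp kernels_into_iff_closed kernels_into_iff by blast+
  have antisym: "A = B" if "ksub_le C A B" "ksub_le C B A" "A \<in> carrier ?L" "B \<in> carrier ?L" for A B
    using that(1,2) rep[OF that(3)] rep[OF that(4)]
    by (metis ksub_le_class ksub_class_cong subset_antisym)
  have trans: "ksub_le C A D"
    if "ksub_le C A B" "ksub_le C B D" "A \<in> carrier ?L" "B \<in> carrier ?L" "D \<in> carrier ?L" for A B D
    using that(1,2) rep[OF that(3)] rep[OF that(4)] rep[OF that(5)] by (force simp: ksub_le_class)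
  have refl: "ksub_le C A A" if "A \<in> carrier ?L" for A
    using rep[OF that] by (metis ksub_le_class subset_refl)
  show ?thesis
  proof
    fix A B assume "A \<in> carrier ?L" "B \<in> carrier ?L"
    then obtain m n where m: "m \<in> kernels_into C X" "A = ksub_class C m"
      and n: "n \<in> kernels_into C X" "B = ksub_class C n"
      using rep by blast
    obtain k where k: "k \<in> kernels_into C X" "sieve C k = sieve C m \<inter> sieve C n"
      "ksub_meet C A B = ksub_class C k"
      using ksub_meet_class[OF m(1) n(1)] m(2) n(2) by metis
    show "olmeet ?L A B \<in> carrier ?L"
      using k cl by simp
    show "le ?L D (olmeet ?L A B) \<longleftrightarrow> le ?L D A \<and> le ?L D B" if "D \<in> carrier ?L" for D
      using rep[OF that] k m n by (auto simp: ksub_le_class)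
    show "oljoin ?L A B = olcompl ?L (olmeet ?L (olcompl ?L A) (olcompl ?L B))"
      by (simp add: ksub_join_def)
    show "le ?L (olcompl ?L B) (olcompl ?L A)" if "le ?L A B"
      using that m n polar_antitone[of "sieve C m" "sieve C n"]
        ksub_le_class[OF perp(1)[OF n(1)] perp(1)[OF m(1)]]
      by (simp add: ksub_perp_class perp ksub_le_class)
  next
    fix A assume "A \<in> carrier ?L"
    then obtain m where m: "m \<in> kernels_into C X" "A = ksub_class C m"
      using rep by blast
    show "olcompl ?L A \<in> carrier ?L"
      using m by (simp add: ksub_perp_class perp cl)
    show "olcompl ?L (olcompl ?L A) = A"
      using m perp[OF m(1)] perp[OF perp(1)[OF m(1)]]
      by (simp add: ksub_perp_class) (rule ksub_class_cong[of _ X]; simp)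
    show "le ?L (olbot ?L) A"
      using m zero_sieve_subset[OF X] ksub_le_class[OF zero_kernel(1)[OF X] m(1)]
      by (auto simp: ksub_bot_def kernels_into_iff)
    show "le ?L A (oltop ?L)"
      using m Id_kernel(2)[OF X] sieve_subset_arrs_into[of m "Dom C m" X]
        ksub_le_class[OF m(1) Id_kernel(1)[OF X]]
      by (auto simp: ksub_top_def kernels_into_iff)
    obtain k where k: "k \<in> kernels_into C X" "sieve C k = sieve C m \<inter> sieve C (perp C m)"
      "ksub_meet C A (ksub_perp C A) = ksub_class C k"
      using ksub_meet_class[OF m(1) perp(1)[OF m(1)]] m ksub_perp_class by metis
    \<comment> \<open>An arrow in a sieve and in its polar is orthogonal to itself, hence zero; this
      gives the complement law.\<close>
    have "sieve C k \<subseteq> sieve C (zero_arr C (zero_obj C) X)"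
      unfolding k(2) perp(2)[OF m(1)] zero_kernel(2)[OF X]
      by (rule inter_polar)
    then have "sieve C k = sieve C (zero_arr C (zero_obj C) X)"
      using zero_sieve_subset[OF X] k(1) kernels_into_iff by blast
    then show "olmeet ?L A (olcompl ?L A) = olbot ?L"
      using k(3) ksub_class_cong[OF k(1) zero_kernel(1)[OF X]] by (simp add: ksub_bot_def)
  next
    show "olbot ?L \<in> carrier ?L" "oltop ?L \<in> carrier ?L"
      using cl zero_kernel(1)[OF X] Id_kernel(1)[OF X] by (simp_all add: ksub_bot_def ksub_top_def)
  qed (auto intro: trans refl dest: antisym)
qed

section \<open>Translation of the Boolean condition\<close>

text \<open>The equation puts \<open>n\<close> into the polar of the sieve of \<open>m\<close>,
  which is the sieve of \<open>perp C m\<close>; a sieve containing \<open>n\<close> contains all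
  that factors through \<open>n\<close>.\<close>

lemma orthogonal_iff_le_perp:
  assumes m: "m \<in> kernels_into C X" and n: "n \<in> kernels_into C X"
  shows "Dag C m \<cdot> n = zero_arr C (Dom C n) (Dom C m) \<longleftrightarrow>
    ksub_le C (ksub_class C n) (ksub_perp C (ksub_class C m))"
proof -
  have mH: "m \<in> Hom C (Dom C m) X" and nH: "n \<in> Hom C (Dom C n) X"
    using m n by (simp_all add: kernels_into_iff)
  have pH: "perp C m \<in> Hom C (Dom C (perp C m)) X"
    using perp_kernel[OF mH] by (simp add: kernels_into_iff)
  have n_into: "n \<in> arrs_into C X"
    using nH by (simp add: arrs_into_def Hom_iff)
  have "Dag C m \<cdot> n = zero_arr C (Dom C n) (Dom C m) \<longleftrightarrow> n \<in> sieve C (perp C m)"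
    using polar_sieve_iff[OF mH] sieve_perp[OF mH] n_into by simp
  also have "\<dots> \<longleftrightarrow> sieve C n \<subseteq> sieve C (perp C m)"
    using sieve_subset_iff[OF nH pH] sieve_iff[OF pH] n_into by simp
  finally show ?thesis
    using ksub_le_class[OF n perp_kernel[OF mH]] ksub_perp_class[OF m] by simp
qed

text \<open>Sorts the pairs of kernels by their common codomain, which brings the condition into the
  form of \<open>boolean_iff_disjoint_orthogonal\<close> for each \<open>KSub C X\<close>.\<close>

lemma boolean_category_iff:
  "boolean_category C \<longleftrightarrow>
    (\<forall>X \<in> Obj C. \<forall>A \<in> carrier (KSub C X). \<forall>B \<in> carrier (KSub C X).
      ksub_meet C A B = ksub_bot C X \<longrightarrow> ksub_le C B (ksub_perp C A))"
    (is "_ \<longleftrightarrow> ?R")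
proof
  assume bool: "boolean_category C"
  show ?R
  proof (intro ballI impI)
    fix X A B
    assume "A \<in> carrier (KSub C X)" "B \<in> carrier (KSub C X)"
      and disj: "ksub_meet C A B = ksub_bot C X"
    then obtain m n where m: "m \<in> kernels_into C X" "A = ksub_class C m"
      and n: "n \<in> kernels_into C X" "B = ksub_class C n"
      unfolding carrier_KSub by blast
    have "is_kernel C m" "is_kernel C n" "Cod C m = X" "Cod C n = X"
      using m n by (simp_all add: kernels_into_def)
    then have "Dag C m \<cdot> n = zero_arr C (Dom C n) (Dom C m)"
      using bool disj m(2) n(2) unfolding boolean_category_def by metis
    then show "ksub_le C B (ksub_perp C A)"
      using orthogonal_iff_le_perp[OF m(1) n(1)] m(2) n(2) by simp
  qed
next
  assume R: ?R
  show "boolean_category C"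
    unfolding boolean_category_def
  proof (intro allI impI)
    fix m n
    assume "is_kernel C m" "is_kernel C n" "Cod C m = Cod C n"
      and disj: "ksub_meet C (ksub_class C m) (ksub_class C n) = ksub_bot C (Cod C m)"
    then have m: "m \<in> kernels_into C (Cod C m)" and n: "n \<in> kernels_into C (Cod C m)"
      by (simp_all add: kernels_into_def)
    have "Cod C m \<in> Obj C"
      using m Hom_Obj(2) kernels_into_iff by blast
    then have "ksub_le C (ksub_class C n) (ksub_perp C (ksub_class C m))"
      using R m n disj unfolding carrier_KSub by blast
    then show "Dag C m \<cdot> n = zero_arr C (Dom C n) (Dom C m)"
      using orthogonal_iff_le_perp[OF m n] by simp
  qed
qed

end

theorem theorem6p3:
  fixes C :: "('o, 'm) dagger_cat"
  assumes "dagger_kernel_category C"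
  shows "boolean_category C \<longleftrightarrow> (\<forall>X \<in> Obj C. boolean_ortholattice (KSub C X))"
proof -
  interpret dagger_kernel_category C by fact
  show ?thesis
    using ortholattice.boolean_iff_disjoint_orthogonal[OF ortholattice_KSub]
    by (simp add: boolean_category_iff)
qed

end
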